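(* Let $M$ be an $n\times n$ complex matrix with spectral radius $0<\rho(M)<1$, and suppose that $M$ has a unique dominant eigenvalue $\lambda_1$, i.e. exactly one eigenvalue $\lambda_1$ with $|\lambda_1|=\rho(M)$. Let $k$ be the smallest positive integer such that $$\frac{1}{\sqrt[k]{3}} \geq \left|\frac{\lambda}{\lambda_1}\right|$$ for all eigenvalues $\lambda\neq\lambda_1$ of $M$. Then for every integer $k'\geq k$ and every $\mathbf{g}\in\mathbb{C}^n$, the generalized Chebyshev acceleration is applicable to the iterative process $$\mathbf{x}^{(m)}=M^{k'}\mathbf{x}^{(m-1)}+\mathbf{h},\qquad \mathbf{h}=(I+M+\cdots+M^{k'-1})\mathbf{g}.$$
   Context: Define, for $\theta=(\theta_1,\theta_2)\in\mathbb{R}^2$, $$\varphi_1(\theta)=\tfrac13\left(e^{2\pi i\theta_1}+e^{-2\pi i\theta_2}+e^{2\pi i(\theta_2-\theta_1)}\right),$$ and let $\Delta=\{\varphi_1(\theta):\theta\in\mathbb{R}^2\}\subset\mathbb{C}$. This is the closed region enclosed by the Steiner hypocycloid (deltoid) $z=(2e^{it}+e^{-2it})/3$, $t\in\mathbb{R}$, with corners at the third roots of unity. An eigenvalue $\lambda$ of a square matrix $M$ is called dominant if $|\lambda|=\rho(M)$. Eigenvalues are considered as elements of the spectrum (without multiplicity). Applicability: the generalized Chebyshev acceleration (the semi-iterative method associated with the root system $A_2$) is said to be applicable to an iterative process $\mathbf{x}^{(m)}=N\mathbf{x}^{(m-1)}+\mathbf{h}$, where $N$ is a square complex matrix with $\rho(N)<1$,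 if $N$ has a nonzero eigenvalue $\mu_1$ with $|\mu_1|=\rho(N)$ such that $\mu/\mu_1\in\Delta$ for every eigenvalue $\mu$ of $N$. *)

theory Defs
  imports "Jordan_Normal_Form.Spectral_Radius"
begin

definition phi1 :: "real \<times> real \<Rightarrow> complex" where
  "phi1 = (\<lambda>(t1, t2). (1 / 3) *
     (exp (2 * of_real pi * \<i> * of_real t1)
      + exp (- (2 * of_real pi * \<i> * of_real t2))
      + exp (2 * of_real pi * \<i> * of_real (t2 - t1))))"

definition Deltoid :: "complex set" where
  "Deltoid = range phi1"

definition dominant_eigenvalue :: "complex mat \<Rightarrow> complex \<Rightarrow> bool" where
  "dominant_eigenvalue M l \<longleftrightarrow> eigenvalue M l \<and> cmod l = spectral_radius M"

text \<open>
  Applicability of the generalized Chebyshev acceleration (the semi-iterative method of the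
  root system \<open>A\<^sub>2\<close>) to the process \<open>x (m) = N x (m - 1) + h\<close>, given by its
  iteration matrix \<open>N\<close> and its constant term \<open>h\<close>. Beyond having the right dimension,
  \<open>h\<close> plays no role in the criterion.
\<close>
definition gen_chebyshev_applicable :: "complex mat \<Rightarrow> complex vec \<Rightarrow> bool" where
  "gen_chebyshev_applicable N h \<longleftrightarrow>
     square_mat N \<and> h \<in> carrier_vec (dim_row N) \<and> spectral_radius N < 1 \<and>
     (\<exists>\<mu>1. \<mu>1 \<noteq> 0 \<and> dominant_eigenvalue N \<mu>1 \<and>
        (\<forall>\<mu>. eigenvalue N \<mu> \<longrightarrow> \<mu> / \<mu>1 \<in> Deltoid))"

end

theory Submission
  imports Defs
begin

text \<open>
  Two facts carry the theorem. Taking powers of a matrix takes powers of its spectrum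
  (lemma \<open>eigenvalue_pow_iff\<close>), so \<open>\<lambda>\<^sub>1 ^ k'\<close> is dominant for \<open>M ^ k'\<close>, and each quotient
  to be tested for membership in the deltoid is the \<open>k'\<close>-th power of a quotient
  \<open>\<lambda> / \<lambda>\<^sub>1\<close>. For \<open>\<lambda> = \<lambda>\<^sub>1\<close> this is the corner \<open>1\<close>. For every other \<open>\<lambda>\<close> the choice of \<open>k\<close>
  bounds its modulus by \<open>1 / 3\<close>, and the deltoid contains the closed disk of that radius,
  its inscribed disk (lemma \<open>cball_third_subset_Deltoid\<close>).

  The inclusion of the disk says that each complex \<open>w\<close> with \<open>|w| \<le> 1\<close> is a sum of three
  unimodular numbers with product \<open>1\<close>. With \<open>c = exp (- 2 i \<alpha>)\<close> as one of them, the other two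
  have the form \<open>exp (i (\<alpha> \<plusminus> \<beta>))\<close>, and their sum is \<open>2 cos \<beta> exp (i \<alpha>)\<close>. Such a \<open>\<beta>\<close> exists as
  soon as \<open>(w - c) exp (- i \<alpha>)\<close> is a real number in \<open>[-2, 2]\<close>. The bound is the triangle
  inequality. The imaginary part changes sign under \<open>\<alpha> \<mapsto> \<alpha> + \<pi>\<close>, so it vanishes for some
  \<open>\<alpha>\<close> by the intermediate value theorem.
\<close>

section \<open>The inscribed disk of the deltoid\<close>

lemma one_in_Deltoid: "1 \<in> Deltoid"
proof -
  have "phi1 (0, 0) = 1"
    by (simp add: phi1_def)
  then show ?thesis
    unfolding Deltoid_def by (metis rangeI)
qed

text \<open>
  In the coordinates \<open>\<alpha>\<close>, \<open>\<beta>\<close> the three exponentials are grouped as one unimodular number and a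
  pair that is symmetric about its inverse square root.
\<close>
lemma cis_sum_in_Deltoid:
  "(1 / 3) * (cis (-2 * \<alpha>) + of_real (2 * cos \<beta>) * cis \<alpha>) \<in> Deltoid"
proof -
  let ?t1 = "(\<alpha> + \<beta>) / (2 * pi)" and ?t2 = "(\<beta> - \<alpha>) / (2 * pi)"
  have e: "exp (2 * of_real pi * \<i> * of_real t) = cis (2 * pi * t)" for t
    by (simp add: cis_conv_exp mult_ac)
  have e1: "exp (2 * of_real pi * \<i> * of_real ?t1) = cis (\<alpha> + \<beta>)"
    unfolding e by simp
  have "exp (- (2 * of_real pi * \<i> * of_real ?t2)) = cis (2 * pi * - ?t2)"
    by (subst e[symmetric]) simp
  also have "2 * pi * - ?t2 = \<alpha> - \<beta>"
    by simp
  finally have e2: "exp (- (2 * of_real pi * \<i> * of_real ?t2)) = cis (\<alpha> - \<beta>)" .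
  have "2 * pi * (?t2 - ?t1) = -2 * \<alpha>"
    by (simp add: field_simps)
  then have e3: "exp (2 * of_real pi * \<i> * of_real (?t2 - ?t1)) = cis (-2 * \<alpha>)"
    unfolding e by (simp only:)
  have "cis (\<alpha> + \<beta>) + cis (\<alpha> - \<beta>) = of_real (2 * cos \<beta>) * cis \<alpha>"
    by (simp add: complex_eq_iff cos_add cos_diff sin_add sin_diff)
  then have "phi1 (?t1, ?t2) = (1 / 3) * (cis (-2 * \<alpha>) + of_real (2 * cos \<beta>) * cis \<alpha>)"
    unfolding phi1_def prod.case e1 e2 e3 by (simp add: algebra_simps)
  then show ?thesis
    unfolding Deltoid_def by (metis rangeI)
qed

text \<open>
  As a function of \<open>\<alpha>\<close> this imaginary part takes the opposite values \<open>Im w\<close> and \<open>- Im w\<close> at \<open>0\<close>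
  and \<open>\<pi>\<close>. A zero makes \<open>w - cis (-2 * \<alpha>)\<close> a real multiple of \<open>cis \<alpha>\<close>, which is the form that a sum
  of two unimodular numbers with product \<open>cis (2 * \<alpha>)\<close> must have.
\<close>
lemma exists_angle_Im_zero:
  fixes w :: complex
  obtains \<alpha> where "Im ((w - cis (-2 * \<alpha>)) * cis (- \<alpha>)) = 0"
proof -
  define f where "f \<alpha> = Im w * cos \<alpha> - Re w * sin \<alpha> + sin (3 * \<alpha>)" for \<alpha>
  have f: "Im ((w - cis (-2 * \<alpha>)) * cis (- \<alpha>)) = f \<alpha>" for \<alpha>
  proof -
    have "(w - cis (-2 * \<alpha>)) * cis (- \<alpha>) = w * cis (- \<alpha>) - cis (- (3 * \<alpha>))"
      by (simp add: left_diff_distrib cis_mult)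
    then show ?thesis
      by (simp add: f_def)
  qed
  have "sin (3 * pi) = 0"
    using sin_npi[of 3] by simp
  then have f_ends: "f 0 = Im w" "f pi = - Im w"
    by (simp_all add: f_def)
  have cont: "continuous_on {0..pi} f"
    unfolding f_def by (intro continuous_intros)
  have "\<exists>\<alpha>. f \<alpha> = 0"
  proof (cases "Im w \<le> 0")
    case True
    then show ?thesis
      using IVT'[OF _ _ _ cont, of 0] f_ends by auto
  next
    case False
    then show ?thesis
      using IVT2'[OF _ _ _ cont, of 0] f_ends by auto
  qed
  then show thesis
    using that f by metis
qed

lemma cball_third_subset_Deltoid:
  assumes "cmod z \<le> 1 / 3"
  shows "z \<in> Deltoid"
proof -
  define w where "w = 3 * z"
  have w: "cmod w \<le> 1"
    using assms by (simp add: w_def norm_mult)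
  obtain \<alpha> where im: "Im ((w - cis (-2 * \<alpha>)) * cis (- \<alpha>)) = 0"
    by (rule exists_angle_Im_zero)
  define r where "r = Re ((w - cis (-2 * \<alpha>)) * cis (- \<alpha>))"
  have r: "(w - cis (-2 * \<alpha>)) * cis (- \<alpha>) = of_real r"
    using im by (simp add: complex_eq_iff r_def del: mult_minus_left)
  have "\<bar>r\<bar> = cmod (w - cis (-2 * \<alpha>))"
    using arg_cong[OF r, of cmod] by (simp add: norm_mult)
  also have "\<dots> \<le> cmod w + cmod (cis (-2 * \<alpha>))"
    by (rule norm_triangle_ineq4)
  also have "\<dots> \<le> 2"
    using w by simp
  finally have "\<bar>r\<bar> \<le> 2" .
  then have cos: "2 * cos (arccos (r / 2)) = r"
    by (simp add: cos_arccos abs_le_iff)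
  have "w - cis (-2 * \<alpha>) = (w - cis (-2 * \<alpha>)) * (cis (- \<alpha>) * cis \<alpha>)"
    by (simp add: cis_mult)
  also have "\<dots> = of_real r * cis \<alpha>"
    unfolding mult.assoc[symmetric] r ..
  finally have "3 * z = cis (-2 * \<alpha>) + of_real r * cis \<alpha>"
    unfolding w_def by (simp only: diff_eq_eq add.commute)
  then have "z = (1 / 3) * (cis (-2 * \<alpha>) + of_real (2 * cos (arccos (r / 2))) * cis \<alpha>)"
    unfolding cos by (simp add: eq_divide_eq mult.commute)
  then show ?thesis
    using cis_sum_in_Deltoid by metis
qed

section \<open>The spectrum of a matrix power\<close>

lemma upper_triangular_mult:
  fixes A B :: "'a :: semiring_0 mat"
  assumes A: "A \<in> carrier_mat n n" and B: "B \<in> carrier_mat n n"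
    and utA: "upper_triangular A" and utB: "upper_triangular B"
  shows "upper_triangular (A * B)"
    and "i < n \<Longrightarrow> (A * B) $$ (i, i) = A $$ (i, i) * B $$ (i, i)"
proof -
  have entry: "(A * B) $$ (i, j) = (\<Sum>l<n. A $$ (i, l) * B $$ (l, j))" if "i < n" "j < n" for i j
    using that A B by (simp add: scalar_prod_def atLeast0LessThan)
  have vanish: "A $$ (i, l) * B $$ (l, j) = 0"
    if "i < n" "l < n" "l < i \<or> j < l" for i j l
    using that A B upper_triangularD[OF utA, of l i] upper_triangularD[OF utB, of j l] by auto
  show "upper_triangular (A * B)"
  proof
    fix i j
    assume ij: "j < i" "i < dim_row (A * B)"
    then have "i < n" "j < n"
      using A by auto
    moreover have "A $$ (i, l) * B $$ (l, j) = 0" if "l < n" for l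
      using that ij \<open>i < n\<close> by (intro vanish) auto
    ultimately show "(A * B) $$ (i, j) = 0"
      by (simp add: entry)
  qed
  show "(A * B) $$ (i, i) = A $$ (i, i) * B $$ (i, i)" if i: "i < n"
  proof -
    have "(\<Sum>l<n. A $$ (i, l) * B $$ (l, i)) = (\<Sum>l\<in>{i}. A $$ (i, l) * B $$ (l, i))"
      using i by (intro sum.mono_neutral_right) (auto intro!: vanish)
    then show ?thesis
      using i by (simp add: entry)
  qed
qed

lemma upper_triangular_pow:
  fixes A :: "'a :: semiring_1 mat"
  assumes A: "A \<in> carrier_mat n n" and ut: "upper_triangular A"
  shows "upper_triangular (A ^\<^sub>m k) \<and> (\<forall>i<n. (A ^\<^sub>m k) $$ (i, i) = A $$ (i, i) ^ k)"
proof (induction k)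
  case 0
  then show ?case
    using A by auto
next
  case (Suc k)
  then show ?case
    using upper_triangular_mult[OF pow_carrier_mat[OF A] A _ ut, of k] by (simp del: power_Suc add: power_Suc2)
qed

lemma eigenvalue_upper_triangular_similar:
  fixes A B :: "'a :: field mat"
  assumes A: "A \<in> carrier_mat n n" and B: "B \<in> carrier_mat n n"
    and sim: "similar_mat A B" and ut: "upper_triangular B"
  shows "eigenvalue A x \<longleftrightarrow> (\<exists>i<n. x = B $$ (i, i))"
proof -
  have roots: "poly (\<Prod>a\<leftarrow>xs. [:- a, 1:]) x = 0 \<longleftrightarrow> x \<in> set xs" for xs :: "'a list"
    by (induction xs) auto
  show ?thesis
    unfolding eigenvalue_root_char_poly[OF A] char_poly_similar[OF sim]
      char_poly_upper_triangular[OF B ut] roots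
    using B by (auto simp: diag_mat_def)
qed

text \<open>
  Schur triangularization turns this into a statement about diagonal entries: the powers of \<open>A\<close>
  are similar to the powers of one triangular matrix, whose diagonal entries are raised to the
  same power.
\<close>
lemma eigenvalue_pow_iff:
  fixes A :: "complex mat"
  assumes A: "A \<in> carrier_mat n n"
  shows "eigenvalue (A ^\<^sub>m k) x \<longleftrightarrow> (\<exists>y. eigenvalue A y \<and> x = y ^ k)"
proof -
  obtain B where B: "B \<in> carrier_mat n n" and ut: "upper_triangular B" and sim: "similar_mat A B"
    using char_poly_factorized[OF A] schur_decomposition_exists[OF A] by blast
  obtain P Q where "similar_mat_wit A B P Q"
    using sim unfolding similar_mat_def by blast
  then have sim_pow: "similar_mat (A ^\<^sub>m k) (B ^\<^sub>m k)"
    unfolding similar_mat_def using similar_mat_wit_pow by blast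
  note pow = upper_triangular_pow[OF B ut, of k]
  have "eigenvalue (A ^\<^sub>m k) x \<longleftrightarrow> (\<exists>i<n. x = (B ^\<^sub>m k) $$ (i, i))"
    using pow A B by (intro eigenvalue_upper_triangular_similar[OF _ _ sim_pow]) auto
  then show ?thesis
    using pow eigenvalue_upper_triangular_similar[OF A B sim ut] by auto
qed

section \<open>Powers of a dominant eigenvalue\<close>

lemma cmod_le_spectral_radius:
  assumes "A \<in> carrier_mat n n" "eigenvalue A x"
  shows "cmod x \<le> spectral_radius A"
  using spectral_radius_mem_max(2)[OF assms(1)] eigenvalue_imp_nonzero_dim[OF assms] assms(2)
  by (simp add: spectrum_def)

lemma dominant_eigenvalueI:
  assumes A: "A \<in> carrier_mat n n" and ev: "eigenvalue A x"
    and max: "\<And>y. eigenvalue A y \<Longrightarrow> cmod y \<le> cmod x"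
  shows "dominant_eigenvalue A x"
proof -
  have "spectral_radius A \<in> cmod ` spectrum A"
    using spectral_radius_mem_max(1)[OF A eigenvalue_imp_nonzero_dim[OF A ev]] .
  then have "spectral_radius A \<le> cmod x"
    using max by (auto simp: spectrum_def)
  then show ?thesis
    using cmod_le_spectral_radius[OF A ev] ev by (simp add: dominant_eigenvalue_def)
qed

lemma dominant_eigenvalue_pow:
  assumes A: "A \<in> carrier_mat n n" and dom: "dominant_eigenvalue A x"
  shows "dominant_eigenvalue (A ^\<^sub>m k) (x ^ k)"
proof (rule dominant_eigenvalueI)
  show "A ^\<^sub>m k \<in> carrier_mat n n"
    using A by simp
  show "eigenvalue (A ^\<^sub>m k) (x ^ k)"
    using dom by (auto simp: eigenvalue_pow_iff[OF A] dominant_eigenvalue_def)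
next
  fix y
  assume "eigenvalue (A ^\<^sub>m k) y"
  then obtain l where "eigenvalue A l" "y = l ^ k"
    by (auto simp: eigenvalue_pow_iff[OF A])
  then show "cmod y \<le> cmod (x ^ k)"
    using cmod_le_spectral_radius[OF A] dom
    by (auto simp: dominant_eigenvalue_def norm_power intro: power_mono)
qed

section \<open>The exponent\<close>

lemma le_inverse_root_iff:
  assumes "0 < j" "0 \<le> r"
  shows "r \<le> 1 / root j 3 \<longleftrightarrow> r ^ j \<le> 1 / 3"
proof -
  have "r \<le> 1 / root j 3 \<longleftrightarrow> r ^ j \<le> (1 / root j 3) ^ j"
    using assms by (simp add: power_mono_iff)
  also have "(1 / root j 3) ^ j = (1 / 3 :: real)"
    using assms by (simp add: power_divide real_root_pow_pos2)
  finally show ?thesis .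
qed

text \<open>
  Finiteness is what makes one exponent work for all numbers at once. It secures that the minimum
  defining \<open>k\<close> in the theorem is attained, so that \<open>k\<close> has the property it is minimal for.
\<close>
lemma exists_uniform_power_le_third:
  fixes S :: "real set"
  assumes fin: "finite S" and S: "\<And>r. r \<in> S \<Longrightarrow> 0 \<le> r \<and> r < 1"
  shows "\<exists>j>0. \<forall>r\<in>S. r ^ j \<le> 1 / 3"
proof -
  have "\<forall>\<^sub>F j in sequentially. r ^ j \<le> 1 / 3" if "r \<in> S" for r
  proof -
    have "(\<lambda>j. r ^ j) \<longlonglongrightarrow> 0"
      using S[OF that] by (intro LIMSEQ_power_zero) simp
    then have "\<forall>\<^sub>F j in sequentially. r ^ j < 1 / 3"
      by (rule order_tendstoD) simp
    then show ?thesis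
      by (rule eventually_mono) simp
  qed
  then have "\<forall>\<^sub>F j in sequentially. \<forall>r\<in>S. r ^ j \<le> 1 / 3"
    using fin by (simp add: eventually_ball_finite)
  then have "\<forall>\<^sub>F j in sequentially. 0 < j \<and> (\<forall>r\<in>S. r ^ j \<le> 1 / 3)"
    using eventually_gt_at_top[of 0] by eventually_elim simp
  then show ?thesis
    using eventually_happens by fastforce
qed

theorem theorem1:
  fixes M :: "complex mat" and n k :: nat and lam1 :: complex
  assumes M: "M \<in> carrier_mat n n"
    and rho_pos: "0 < spectral_radius M"
    and rho_less: "spectral_radius M < 1"
    and dom: "dominant_eigenvalue M lam1"
    and uniq: "\<And>l. dominant_eigenvalue M l \<Longrightarrow> l = lam1"
    and k: "k = (LEAST j. 0 < j \<and>
              (\<forall>l. eigenvalue M l \<and> l \<noteq> lam1 \<longrightarrow> 1 / root j 3 \<ge> cmod (l / lam1)))"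
  shows "\<forall>k' \<ge> k. \<forall>g \<in> carrier_vec n.
           gen_chebyshev_applicable (M ^\<^sub>m k')
             (finsum (ring_mat TYPE(complex) n ()) (\<lambda>i. M ^\<^sub>m i) {..<k'} *\<^sub>v g)"
proof (intro allI impI ballI)
  fix k' :: nat and g :: "complex vec"
  assume k': "k \<le> k'" and g: "g \<in> carrier_vec n"
  have rho: "cmod lam1 = spectral_radius M" and lam1: "lam1 \<noteq> 0"
    using dom rho_pos by (auto simp: dominant_eigenvalue_def)
  have ratio_less: "cmod (l / lam1) < 1" if "eigenvalue M l" "l \<noteq> lam1" for l
  proof -
    \<comment> \<open>an eigenvalue on the spectral circle would be dominant, against uniqueness\<close>
    have "cmod l \<noteq> spectral_radius M"
      using that uniq by (auto simp: dominant_eigenvalue_def)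
    then have "cmod l < cmod lam1"
      using cmod_le_spectral_radius[OF M that(1)] rho by simp
    then show ?thesis
      using lam1 by (simp add: norm_divide)
  qed
  let ?P = "\<lambda>j. 0 < j \<and> (\<forall>l. eigenvalue M l \<and> l \<noteq> lam1 \<longrightarrow> 1 / root j 3 \<ge> cmod (l / lam1))"
  let ?S = "(\<lambda>l. cmod (l / lam1)) ` (spectrum M - {lam1})"
  have "\<exists>j>0. \<forall>r\<in>?S. r ^ j \<le> 1 / 3"
  proof (rule exists_uniform_power_le_third)
    show "finite ?S"
      using card_finite_spectrum(1)[OF M] by simp
    show "0 \<le> r \<and> r < 1" if "r \<in> ?S" for r
      using that ratio_less by (auto simp: spectrum_def)
  qed
  then obtain j where j: "0 < j" "\<forall>r\<in>?S. r ^ j \<le> 1 / 3"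
    by blast
  have "?P j"
  proof (intro conjI allI impI)
    fix l
    assume "eigenvalue M l \<and> l \<noteq> lam1"
    then have "cmod (l / lam1) ^ j \<le> 1 / 3"
      using j(2) by (auto simp: spectrum_def)
    then show "1 / root j 3 \<ge> cmod (l / lam1)"
      using le_inverse_root_iff[OF j(1) norm_ge_zero] by blast
  qed (fact j(1))
  then have "?P k"
    unfolding k by (rule LeastI)
  then have k_pos: "0 < k"
    and k_root: "\<And>l. eigenvalue M l \<Longrightarrow> l \<noteq> lam1 \<Longrightarrow> cmod (l / lam1) \<le> 1 / root k 3"
    by auto
  have k'_pos: "0 < k'"
    using k_pos k' by simp
  have dom_pow: "dominant_eigenvalue (M ^\<^sub>m k') (lam1 ^ k')"
    by (rule dominant_eigenvalue_pow[OF M dom])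
  have "cmod lam1 ^ k' < 1"
    using rho rho_pos rho_less k'_pos by (intro power_less_one_iff[THEN iffD2]) auto
  then have radius: "spectral_radius (M ^\<^sub>m k') < 1"
    using dom_pow by (simp add: dominant_eigenvalue_def norm_power)
  have deltoid: "\<mu> / lam1 ^ k' \<in> Deltoid" if ev: "eigenvalue (M ^\<^sub>m k') \<mu>" for \<mu>
  proof -
    obtain l where l: "eigenvalue M l" "\<mu> = l ^ k'"
      using ev by (auto simp: eigenvalue_pow_iff[OF M])
    show ?thesis
    proof (cases "l = lam1")
      case True
      then show ?thesis
        using l lam1 one_in_Deltoid by simp
    next
      case False
      have "cmod (l / lam1) ^ k' \<le> cmod (l / lam1) ^ k"
        using ratio_less[OF l(1) False] k' by (intro power_decreasing) auto
      also have "\<dots> \<le> 1 / 3"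
        using le_inverse_root_iff[OF k_pos norm_ge_zero] k_root l(1) False by blast
      finally have "cmod (\<mu> / lam1 ^ k') \<le> 1 / 3"
        by (simp add: l(2) norm_power norm_divide power_divide)
      then show ?thesis
        by (rule cball_third_subset_Deltoid)
    qed
  qed
  interpret R: ring "ring_mat TYPE(complex) n ()"
    by (rule ring_mat)
  have "finsum (ring_mat TYPE(complex) n ()) (\<lambda>i. M ^\<^sub>m i) {..<k'}
      \<in> carrier (ring_mat TYPE(complex) n ())"
    using M by (intro R.finsum_closed) (auto simp: ring_mat_simps)
  then have "finsum (ring_mat TYPE(complex) n ()) (\<lambda>i. M ^\<^sub>m i) {..<k'} *\<^sub>v g \<in> carrier_vec n"
    using g by (auto simp: ring_mat_simps intro: mult_mat_vec_carrier)
  moreover have "square_mat (M ^\<^sub>m k')" "dim_row (M ^\<^sub>m k') = n"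
    using M by auto
  moreover have "lam1 ^ k' \<noteq> 0"
    using lam1 by simp
  ultimately show "gen_chebyshev_applicable (M ^\<^sub>m k')
      (finsum (ring_mat TYPE(complex) n ()) (\<lambda>i. M ^\<^sub>m i) {..<k'} *\<^sub>v g)"
    using radius dom_pow deltoid unfolding gen_chebyshev_applicable_def by metis
qed

end
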